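(* Let $K$ be a compact metric space and let $X$ be a $2$-dimensional subspace of $C(K)$ (real or complex scalars). Then $X$ does not have the $2$-summing property if and only if there exist vectors $x_1,x_2$ in $X$ and a closed set $K_0\subset K$ with $1_{K_0}\le|x_1|^2+|x_2|^2\le1$ (pointwise on $K$) such that for every $x\in X$ with $\|x\|_\infty=1$ we have $|x|_{|K_0}\not\equiv1$.
   Context: The scalar field is $\mathbb{R}$ or $\mathbb{C}$; $X$ carries the sup norm; $1_{K_0}$ is the indicator function of $K_0$. For an operator $T:X\to Y$ between Banach spaces, $\pi_2(T)=\sup\big(\sum_{i=1}^n\|TUe_i\|^2\big)^{1/2}$, the supremum over all $n\ge1$ and operators $U:\ell_2^n\to X$ with $\|U\|\le1$, where $(e_i)$ is the unit vector basis of $\ell_2^n$. $X$ has the $2$-summing property if $\pi_2(T)=\|T\|$ for every bounded linear operator $T:X\to\ell_2$. *)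

theory Defs
  imports "HOL-Analysis.Analysis"
begin

section \<open>The Hilbert space of square-summable sequences\<close>

typedef (overloaded) 'k ell2 = "{a :: nat \<Rightarrow> 'k::real_normed_field. summable (\<lambda>n. (norm (a n))\<^sup>2)}"
  morphisms ell2_nth Abs_ell2
  by (rule exI[of _ "\<lambda>_. 0"]) simp

setup_lifting type_definition_ell2

lemma ell2_L2_set_le:
  fixes a :: "nat \<Rightarrow> 'k::real_normed_field"
  assumes "summable (\<lambda>n. (norm (a n))\<^sup>2)"
  shows "L2_set (\<lambda>n. norm (a n)) {..<N} \<le> sqrt (\<Sum>n. (norm (a n))\<^sup>2)"
  unfolding L2_set_def by (intro real_sqrt_le_mono sum_le_suminf assms) auto

lemma ell2_add_aux:
  fixes a b :: "nat \<Rightarrow> 'k::real_normed_field"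
  assumes a: "summable (\<lambda>n. (norm (a n))\<^sup>2)" and b: "summable (\<lambda>n. (norm (b n))\<^sup>2)"
  shows "(\<Sum>n<N. (norm (a n + b n))\<^sup>2)
           \<le> (sqrt (\<Sum>n. (norm (a n))\<^sup>2) + sqrt (\<Sum>n. (norm (b n))\<^sup>2))\<^sup>2"
proof -
  have "L2_set (\<lambda>n. norm (a n + b n)) {..<N} \<le> L2_set (\<lambda>n. norm (a n) + norm (b n)) {..<N}"
    by (intro L2_set_mono norm_triangle_ineq) auto
  also have "\<dots> \<le> L2_set (\<lambda>n. norm (a n)) {..<N} + L2_set (\<lambda>n. norm (b n)) {..<N}"
    by (rule L2_set_triangle_ineq)
  also have "\<dots> \<le> sqrt (\<Sum>n. (norm (a n))\<^sup>2) + sqrt (\<Sum>n. (norm (b n))\<^sup>2)"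
    by (intro add_mono ell2_L2_set_le a b)
  finally show ?thesis
    unfolding L2_set_def by (rule sqrt_le_D)
qed

lemma ell2_summable_add:
  fixes a b :: "nat \<Rightarrow> 'k::real_normed_field"
  assumes "summable (\<lambda>n. (norm (a n))\<^sup>2)" "summable (\<lambda>n. (norm (b n))\<^sup>2)"
  shows "summable (\<lambda>n. (norm (a n + b n))\<^sup>2)"
  by (rule summableI_nonneg_bounded[OF _ ell2_add_aux[OF assms]]) simp

lemma ell2_triangle:
  fixes a b :: "nat \<Rightarrow> 'k::real_normed_field"
  assumes "summable (\<lambda>n. (norm (a n))\<^sup>2)" "summable (\<lambda>n. (norm (b n))\<^sup>2)"
  shows "sqrt (\<Sum>n. (norm (a n + b n))\<^sup>2) \<le> sqrt (\<Sum>n. (norm (a n))\<^sup>2) + sqrt (\<Sum>n. (norm (b n))\<^sup>2)"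
  by (rule real_le_lsqrt)
     (auto intro!: add_nonneg_nonneg suminf_nonneg assms suminf_le_const ell2_summable_add ell2_add_aux)

lemma ell2_summable_scale:
  fixes a :: "nat \<Rightarrow> 'k::real_normed_field"
  shows "summable (\<lambda>n. (norm (a n))\<^sup>2) \<Longrightarrow> summable (\<lambda>n. (norm (c * a n))\<^sup>2)"
  by (simp add: norm_mult power_mult_distrib summable_mult)

instantiation ell2 :: (real_normed_field) real_normed_vector
begin

lift_definition zero_ell2 :: "'a ell2" is "\<lambda>_. 0" by simp
lift_definition plus_ell2 :: "'a ell2 \<Rightarrow> 'a ell2 \<Rightarrow> 'a ell2" is "\<lambda>a b n. a n + b n"
  by (rule ell2_summable_add)
lift_definition uminus_ell2 :: "'a ell2 \<Rightarrow> 'a ell2" is "\<lambda>a n. - a n" by simp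
definition minus_ell2 :: "'a ell2 \<Rightarrow> 'a ell2 \<Rightarrow> 'a ell2" where "minus_ell2 a b = a + - b"
lift_definition scaleR_ell2 :: "real \<Rightarrow> 'a ell2 \<Rightarrow> 'a ell2" is "\<lambda>r a n. r *\<^sub>R a n"
  by (simp add: power_mult_distrib summable_mult)
lift_definition norm_ell2 :: "'a ell2 \<Rightarrow> real" is "\<lambda>a. sqrt (\<Sum>n. (norm (a n))\<^sup>2)" .
definition dist_ell2 :: "'a ell2 \<Rightarrow> 'a ell2 \<Rightarrow> real" where "dist_ell2 a b = norm (a - b)"
definition sgn_ell2 :: "'a ell2 \<Rightarrow> 'a ell2" where "sgn_ell2 a = inverse (norm a) *\<^sub>R a"
definition uniformity_ell2 :: "('a ell2 \<times> 'a ell2) filter"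
  where "uniformity_ell2 = (INF e\<in>{0<..}. principal {(a, b). dist a b < e})"
definition open_ell2 :: "'a ell2 set \<Rightarrow> bool"
  where "open_ell2 S = (\<forall>a\<in>S. \<forall>\<^sub>F (a', b) in uniformity. a' = a \<longrightarrow> b \<in> S)"

instance
proof
  fix a b c :: "'a ell2" and r s :: real
  show "a + b + c = a + (b + c)" by transfer (simp add: add.assoc)
  show "a + b = b + a" by transfer (simp add: add.commute)
  show "0 + a = a" by transfer simp
  show "- a + a = 0" by transfer simp
  show "a - b = a + - b" by (rule minus_ell2_def)
  show "r *\<^sub>R (a + b) = r *\<^sub>R a + r *\<^sub>R b" by transfer (simp add: scaleR_add_right)
  show "(r + s) *\<^sub>R a = r *\<^sub>R a + s *\<^sub>R a" by transfer (simp add: scaleR_add_left)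
  show "r *\<^sub>R s *\<^sub>R a = (r * s) *\<^sub>R a" by transfer simp
  show "1 *\<^sub>R a = a" by transfer simp
  show "dist a b = norm (a - b)" by (rule dist_ell2_def)
  show "sgn a = inverse (norm a) *\<^sub>R a" by (rule sgn_ell2_def)
  show "uniformity = (INF e\<in>{0<..}. principal {(a :: 'a ell2, b). dist a b < e})"
    by (rule uniformity_ell2_def)
  show "open S = (\<forall>a\<in>S. \<forall>\<^sub>F (a', b) in uniformity. a' = a \<longrightarrow> b \<in> S)" for S :: "'a ell2 set"
    by (rule open_ell2_def)
  show "norm a = 0 \<longleftrightarrow> a = 0"
    by transfer (auto simp: suminf_eq_zero_iff)
  show "norm (a + b) \<le> norm a + norm b"
    by transfer (rule ell2_triangle)
  show "norm (r *\<^sub>R a) = \<bar>r\<bar> * norm a"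
    by transfer (simp add: power_mult_distrib suminf_mult real_sqrt_mult)
qed

end

lift_definition ell2_scale :: "'k::real_normed_field \<Rightarrow> 'k ell2 \<Rightarrow> 'k ell2" is "\<lambda>c a n. c * a n"
  by (rule ell2_summable_scale)

lift_definition ell2_unit :: "nat \<Rightarrow> 'k::real_normed_field ell2" is "\<lambda>i n. if n = i then 1 else 0"
proof -
  fix i :: nat
  have "(\<lambda>n. (norm (if n = i then 1 else 0 :: 'k))\<^sup>2) = (\<lambda>n. if n = i then 1 else 0)"
    by auto
  then show "summable (\<lambda>n. (norm (if n = i then 1 else 0 :: 'k))\<^sup>2)"
    by simp
qed

text \<open>The \<open>n\<close>-dimensional space is realised isometrically inside the sequence space, as the
  sequences supported on the first \<open>n\<close> coordinates.\<close>

definition ell2_fin :: "nat \<Rightarrow> 'k::real_normed_field ell2 set" where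
  "ell2_fin n = {a. \<forall>i\<ge>n. ell2_nth a i = 0}"


section \<open>Continuous functions as a vector space over their field of values\<close>

text \<open>On a compact domain all continuous functions are bounded, so that \<open>'a \<Rightarrow>\<^sub>C 'k\<close> is the space
  of all continuous functions with the supremum norm. The library only provides real scalars.\<close>

unbundle bcontfun.lifting

lift_definition bcontfun_scale ::
    "'k::real_normed_field \<Rightarrow> ('a::topological_space \<Rightarrow>\<^sub>C 'k) \<Rightarrow> ('a \<Rightarrow>\<^sub>C 'k)"
  is "\<lambda>c f t. c * f t"
proof -
  fix c :: 'k and f :: "'a \<Rightarrow> 'k"
  assume "f \<in> bcontfun"
  then have "continuous_on UNIV f" and "bounded (range f)"
    by (auto simp: bcontfun_def)
  then have "bounded ((\<lambda>x. c * x) ` range f)"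
    by (intro bounded_linear_image bounded_linear_mult_right)
  with \<open>continuous_on UNIV f\<close> show "(\<lambda>t. c * f t) \<in> bcontfun"
    by (auto simp: bcontfun_def image_image intro!: continuous_intros)
qed

lifting_update bcontfun.lifting
lifting_forget bcontfun.lifting

interpretation bcontfun: vector_space
  "bcontfun_scale :: 'k::real_normed_field \<Rightarrow> ('a::topological_space \<Rightarrow>\<^sub>C 'k) \<Rightarrow> ('a \<Rightarrow>\<^sub>C 'k)"
proof
  fix c d :: 'k and f g :: "'a \<Rightarrow>\<^sub>C 'k"
  show "bcontfun_scale c (f + g) = bcontfun_scale c f + bcontfun_scale c g"
    by (rule bcontfun_eqI) (simp add: bcontfun_scale.rep_eq plus_bcontfun.rep_eq distrib_left)
  show "bcontfun_scale (c + d) f = bcontfun_scale c f + bcontfun_scale d f"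
    by (rule bcontfun_eqI) (simp add: bcontfun_scale.rep_eq plus_bcontfun.rep_eq distrib_right)
  show "bcontfun_scale c (bcontfun_scale d f) = bcontfun_scale (c * d) f"
    by (rule bcontfun_eqI) (simp add: bcontfun_scale.rep_eq mult.assoc)
  show "bcontfun_scale 1 f = f"
    by (rule bcontfun_eqI) (simp add: bcontfun_scale.rep_eq)
qed


section \<open>The 2-summing property\<close>

text \<open>Operators are only constrained on their domain \<open>V\<close>; a scalar multiplication is passed
  explicitly, since the library has no type class of complex normed spaces.\<close>

definition linear_on ::
    "('k \<Rightarrow> 'v \<Rightarrow> 'v) \<Rightarrow> ('k \<Rightarrow> 'w \<Rightarrow> 'w) \<Rightarrow> 'v::real_normed_vector set
      \<Rightarrow> 'w::real_normed_vector set \<Rightarrow> ('v \<Rightarrow> 'w) \<Rightarrow> bool" where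
  "linear_on s s' V W T \<longleftrightarrow>
     T ` V \<subseteq> W \<and> (\<forall>x\<in>V. \<forall>y\<in>V. T (x + y) = T x + T y) \<and> (\<forall>c. \<forall>x\<in>V. T (s c x) = s' c (T x))"

definition bounded_linear_on ::
    "('k \<Rightarrow> 'v \<Rightarrow> 'v) \<Rightarrow> ('k \<Rightarrow> 'w \<Rightarrow> 'w) \<Rightarrow> 'v::real_normed_vector set
      \<Rightarrow> 'w::real_normed_vector set \<Rightarrow> ('v \<Rightarrow> 'w) \<Rightarrow> bool" where
  "bounded_linear_on s s' V W T \<longleftrightarrow>
     linear_on s s' V W T \<and> (\<exists>B. \<forall>x\<in>V. norm (T x) \<le> norm x * B)"

definition opnorm_on :: "'v::real_normed_vector set \<Rightarrow> ('v \<Rightarrow> 'w::real_normed_vector) \<Rightarrow> ennreal" where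
  "opnorm_on V T = (SUP x\<in>{x\<in>V. norm x \<le> 1}. ennreal (norm (T x)))"

definition pi2 ::
    "('k::real_normed_field \<Rightarrow> 'v \<Rightarrow> 'v) \<Rightarrow> 'v::real_normed_vector set
      \<Rightarrow> ('v \<Rightarrow> 'w::real_normed_vector) \<Rightarrow> ennreal" where
  "pi2 s V T =
     (SUP (n, U) \<in> {(n, U :: 'k ell2 \<Rightarrow> 'v).
          n \<ge> 1 \<and> bounded_linear_on ell2_scale s (ell2_fin n) V U \<and> opnorm_on (ell2_fin n) U \<le> 1}.
        ennreal (sqrt (\<Sum>i<n. (norm (T (U (ell2_unit i))))\<^sup>2)))"

definition two_summing_property ::
    "('k::real_normed_field \<Rightarrow> 'v \<Rightarrow> 'v) \<Rightarrow> 'v::real_normed_vector set \<Rightarrow> bool" where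
  "two_summing_property s V \<longleftrightarrow>
     (\<forall>T :: 'v \<Rightarrow> 'k ell2. bounded_linear_on s ell2_scale V UNIV T \<longrightarrow> pi2 s V T = opnorm_on V T)"

end

theory Submission
  imports Defs
begin

text \<open>An operator \<open>U\<close> from Hilbert space into \<open>X\<close> only enters through the positive form
  \<open>\<Sum> |L (U e\<^sub>i)|\<^sup>2\<close> in the functional \<open>L\<close>. As \<open>X\<close> is two-dimensional, this form is already of the shape
  \<open>|L x\<^sub>1|\<^sup>2 + |L x\<^sub>2|\<^sup>2\<close>, so \<open>\<pi>\<^sub>2(T)\<^sup>2\<close> is the maximum of \<open>\<parallel>T x\<^sub>1\<parallel>\<^sup>2 + \<parallel>T x\<^sub>2\<parallel>\<^sup>2\<close> over the pairs with
  \<open>|x\<^sub>1|\<^sup>2 + |x\<^sub>2|\<^sup>2 \<le> 1\<close> on \<open>K\<close>, whereas \<open>\<parallel>T\<parallel>\<^sup>2\<close> is the maximum over pairs of rank one.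

  If \<open>x\<^sub>1, x\<^sub>2, K\<^sub>0\<close> are as in the statement, compactness of the unit ball of \<open>X\<close> gives finitely many
  points \<open>t\<^sub>1, \<dots>, t\<^sub>m\<close> of \<open>K\<^sub>0\<close> such that each \<open>x\<close> in the ball has \<open>|x(t\<^sub>i)| < 1\<close> for some \<open>i\<close>; then
  \<open>T x = (x(t\<^sub>i))\<^sub>i\<close> has \<open>\<parallel>T\<parallel>\<^sup>2 < m \<le> \<pi>\<^sub>2(T)\<^sup>2\<close>.

  Conversely, let \<open>\<parallel>T\<parallel> < \<pi>\<^sub>2(T)\<close>, let \<open>(x\<^sub>1, x\<^sub>2)\<close> be a maximising pair and \<open>K\<^sub>0 = {|x\<^sub>1|\<^sup>2 + |x\<^sub>2|\<^sup>2 = 1}\<close>. The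
  pair is independent, hence its form \<open>A\<close> is positive definite. If some \<open>x\<close> of norm 1 had \<open>|x| = 1\<close>
  on \<open>K\<^sub>0\<close>, with rank-one form \<open>B\<close>, then for small \<open>s, \<epsilon> > 0\<close> the form \<open>A + s(A - B - \<epsilon>A)\<close> would be
  positive, bounded by 1 on \<open>K\<close>, and would beat \<open>A\<close>, because \<open>\<parallel>T x\<parallel>\<^sup>2 \<le> \<parallel>T\<parallel>\<^sup>2 < \<pi>\<^sub>2(T)\<^sup>2\<close>.\<close>

section \<open>Positive forms in two variables\<close>

text \<open>This is complex conjugation, written so that it makes sense for the real and the complex
  scalars alike; it is the adjoint of multiplication for the real inner product.\<close>

definition adj :: "'k::{real_normed_field,real_inner} \<Rightarrow> 'k" where
  "adj c = of_real ((norm c)\<^sup>2) / c"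

lemma mult_adj: "c * adj c = of_real ((norm c)\<^sup>2)"
  by (simp add: adj_def)

lemma norm_adj [simp]: "norm (adj c) = norm c"
  by (cases "c = 0") (simp_all add: adj_def norm_divide norm_power, simp add: power2_eq_square)

lemma norm_add_sq: "(norm (x + y))\<^sup>2 = (norm x)\<^sup>2 + (norm y)\<^sup>2 + 2 * inner x y"
  for x y :: "'a::real_inner"
  by (simp add: power2_norm_eq_inner inner_add inner_commute)

text \<open>Multiplication by \<open>c\<close> scales all norms by \<open>norm c\<close>, and the
  inner product is recovered from the norm by polarisation.\<close>

lemma inner_mult_mult:
  fixes c x y :: "'k::{real_normed_field,real_inner}"
  shows "inner (c * x) (c * y) = (norm c)\<^sup>2 * inner x y"
proof -
  have "(norm (c * x + c * y))\<^sup>2 = (norm c)\<^sup>2 * (norm (x + y))\<^sup>2"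
    by (simp add: norm_mult power_mult_distrib flip: distrib_left)
  then show ?thesis
    unfolding norm_add_sq by (simp add: norm_mult power_mult_distrib algebra_simps)
qed

lemma inner_mult_adj:
  fixes c x y :: "'k::{real_normed_field,real_inner}"
  shows "inner (c * x) y = inner x (adj c * y)"
proof (cases "c = 0")
  case True
  then show ?thesis by (simp add: adj_def)
next
  case False
  \<comment> \<open>Writing \<open>y\<close> as a multiple of \<open>c\<close> lets \<open>c\<close>
    act on both arguments, where the scaling rule applies.\<close>
  then have "inner (c * x) y = inner (c * x) (c * (y / c))" by simp
  also have "\<dots> = inner x ((norm c)\<^sup>2 *\<^sub>R (y / c))"
    by (simp only: inner_mult_mult inner_scaleR_right)
  also have "(norm c)\<^sup>2 *\<^sub>R (y / c) = adj c * y"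
    by (simp add: adj_def scaleR_conv_of_real)
  finally show ?thesis .
qed

text \<open>Completing the square: for \<open>\<alpha> > 0\<close> the remainder is
  \<open>\<delta>\<close> times the square of \<open>norm w\<close>, with \<open>\<delta>\<close>
  the Schur complement, nonnegative by the determinant condition. For \<open>\<alpha> = 0\<close>
  that condition forces \<open>\<gamma> = 0\<close>.\<close>

lemma psd_form_two_squares:
  fixes \<gamma> :: "'k::{real_normed_field,real_inner}"
  assumes "\<alpha> \<ge> 0" "\<beta> \<ge> 0" and \<gamma>: "(norm \<gamma>)\<^sup>2 \<le> \<alpha> * \<beta>"
  obtains p q r :: 'k where
    "\<And>z w. (norm (p * z + q * w))\<^sup>2 + (norm (r * w))\<^sup>2
       = \<alpha> * (norm z)\<^sup>2 + \<beta> * (norm w)\<^sup>2 + 2 * inner z (\<gamma> * w)"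
proof (cases "\<alpha> = 0")
  case True
  with \<gamma> have "\<gamma> = 0" by simp
  with True \<open>\<beta> \<ge> 0\<close> show ?thesis
    by (intro that[of 0 0 "of_real (sqrt \<beta>)"]) (simp add: norm_mult power_mult_distrib)
next
  case False
  with \<open>\<alpha> \<ge> 0\<close> have "\<alpha> > 0" by simp
  define q where "q = \<gamma> / of_real (sqrt \<alpha>)"
  define \<delta> where "\<delta> = \<beta> - (norm \<gamma>)\<^sup>2 / \<alpha>"
  have \<delta>: "\<delta> \<ge> 0" using \<gamma> \<open>\<alpha> > 0\<close> by (simp add: \<delta>_def field_simps)
  have nq: "(norm q)\<^sup>2 = (norm \<gamma>)\<^sup>2 / \<alpha>"
    using \<open>\<alpha> > 0\<close> by (simp add: q_def norm_divide power_divide)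
  have "inner (of_real (sqrt \<alpha>) * z) (q * w) = inner z (\<gamma> * w)" for z w
  proof -
    have "inner (of_real (sqrt \<alpha>) * z) (q * w) = inner z (sqrt \<alpha> *\<^sub>R (q * w))"
      by (simp flip: scaleR_conv_of_real)
    also have "sqrt \<alpha> *\<^sub>R (q * w) = \<gamma> * w"
      using \<open>\<alpha> > 0\<close> by (simp add: q_def scaleR_conv_of_real)
    finally show ?thesis .
  qed
  then show ?thesis
    using \<open>\<alpha> > 0\<close> \<delta>
    by (intro that[of "of_real (sqrt \<alpha>)" q "of_real (sqrt \<delta>)"])
       (simp add: norm_add_sq norm_mult power_mult_distrib nq, simp add: \<delta>_def algebra_simps)
qed

text \<open>A sum of squares of linear forms in two variables has a 2 by 2 Gram matrix; its
  determinant is nonnegative by Cauchy-Schwarz, so two squares suffice.\<close>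

lemma gram_two_squares:
  fixes a b :: "'i \<Rightarrow> 'k::{real_normed_field,real_inner}"
  obtains p q r :: 'k where
    "\<And>z w. (\<Sum>i\<in>I. (norm (a i * z + b i * w))\<^sup>2) = (norm (p * z + q * w))\<^sup>2 + (norm (r * w))\<^sup>2"
proof -
  define \<gamma> where "\<gamma> = (\<Sum>i\<in>I. adj (a i) * b i)"
  have "norm \<gamma> \<le> (\<Sum>i\<in>I. norm (a i) * norm (b i))"
    unfolding \<gamma>_def by (rule order_trans[OF norm_sum]) (simp add: norm_mult)
  then have "(norm \<gamma>)\<^sup>2 \<le> (\<Sum>i\<in>I. norm (a i) * norm (b i))\<^sup>2"
    by (intro power_mono) auto
  also have "\<dots> \<le> (\<Sum>i\<in>I. (norm (a i))\<^sup>2) * (\<Sum>i\<in>I. (norm (b i))\<^sup>2)"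
    by (rule Cauchy_Schwarz_ineq_sum)
  finally have "(norm \<gamma>)\<^sup>2 \<le> (\<Sum>i\<in>I. (norm (a i))\<^sup>2) * (\<Sum>i\<in>I. (norm (b i))\<^sup>2)" .
  then obtain p q r :: 'k where pqr: "\<And>z w. (norm (p * z + q * w))\<^sup>2 + (norm (r * w))\<^sup>2
       = (\<Sum>i\<in>I. (norm (a i))\<^sup>2) * (norm z)\<^sup>2 + (\<Sum>i\<in>I. (norm (b i))\<^sup>2) * (norm w)\<^sup>2 + 2 * inner z (\<gamma> * w)"
    by (rule psd_form_two_squares[rotated 2]) (auto intro: sum_nonneg)
  show ?thesis
  proof (rule that)
    fix z w
    have "(\<Sum>i\<in>I. (norm (a i * z + b i * w))\<^sup>2)
      = (\<Sum>i\<in>I. (norm (a i))\<^sup>2 * (norm z)\<^sup>2 + (norm (b i))\<^sup>2 * (norm w)\<^sup>2 + 2 * inner z (adj (a i) * b i * w))"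
      by (simp add: norm_add_sq norm_mult power_mult_distrib inner_mult_adj mult.assoc)
    also have "\<dots> = (norm (p * z + q * w))\<^sup>2 + (norm (r * w))\<^sup>2"
      unfolding pqr \<gamma>_def
      by (simp add: sum.distrib sum_distrib_right inner_sum_right flip: sum_distrib_left)
    finally show "(\<Sum>i\<in>I. (norm (a i * z + b i * w))\<^sup>2) = (norm (p * z + q * w))\<^sup>2 + (norm (r * w))\<^sup>2" .
  qed
qed

lemma perturbed_form_two_squares:
  fixes c d :: "'k::{real_normed_field,real_inner}"
  assumes "s \<ge> 0" and s: "s * ((norm c)\<^sup>2 + (norm d)\<^sup>2) \<le> \<mu>"
  obtains p q r :: 'k where
    "\<And>z w. (norm (p * z + q * w))\<^sup>2 + (norm (r * w))\<^sup>2
       = \<mu> * ((norm z)\<^sup>2 + (norm w)\<^sup>2) - s * (norm (c * z + d * w))\<^sup>2"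
proof -
  have s': "s * (norm c)\<^sup>2 + s * (norm d)\<^sup>2 \<le> \<mu>" using s by (simp add: algebra_simps)
  have nn: "0 \<le> s * (norm c)\<^sup>2" "0 \<le> s * (norm d)\<^sup>2" using \<open>s \<ge> 0\<close> by auto
  \<comment> \<open>The right-hand side is the determinant of the form \<open>\<mu> A - s B\<close>,
    where \<open>A\<close> is the standard form and \<open>B\<close> the rank-one form of
    \<open>(c, d)\<close>.\<close>
  have \<mu>: "0 \<le> \<mu> * (\<mu> - s * (norm c)\<^sup>2 - s * (norm d)\<^sup>2)" using s' nn by simp
  have "(norm (of_real (- s) * (adj c * d)))\<^sup>2 \<le> (\<mu> - s * (norm c)\<^sup>2) * (\<mu> - s * (norm d)\<^sup>2)"
    using \<mu> by (simp add: norm_mult power_mult_distrib algebra_simps power2_eq_square)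
  then obtain p q r :: 'k where pqr: "\<And>z w. (norm (p * z + q * w))\<^sup>2 + (norm (r * w))\<^sup>2
       = (\<mu> - s * (norm c)\<^sup>2) * (norm z)\<^sup>2 + (\<mu> - s * (norm d)\<^sup>2) * (norm w)\<^sup>2
         + 2 * inner z (of_real (- s) * (adj c * d) * w)"
    by (rule psd_form_two_squares[rotated 2]) (use s' nn in auto)
  show ?thesis
  proof (rule that)
    fix z w
    have "inner z (of_real (- s) * (adj c * d) * w) = - s * inner (c * z) (d * w)"
      by (simp add: inner_mult_adj mult.assoc flip: scaleR_conv_of_real)
    then show "(norm (p * z + q * w))\<^sup>2 + (norm (r * w))\<^sup>2
       = \<mu> * ((norm z)\<^sup>2 + (norm w)\<^sup>2) - s * (norm (c * z + d * w))\<^sup>2"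
      unfolding pqr by (simp add: norm_add_sq norm_mult power_mult_distrib algebra_simps)
  qed
qed

section \<open>Linear combinations and linear functionals on continuous functions\<close>

lemma bcontfun_mem_span_pairE:
  assumes "x \<in> bcontfun.span {f, g}"
  obtains p q where "x = bcontfun_scale p f + bcontfun_scale q g"
proof -
  obtain p q where "x - bcontfun_scale p f - bcontfun_scale q g = 0"
    using assms unfolding bcontfun.span_breakdown_eq bcontfun.span_empty by blast
  then show ?thesis by (intro that[of p q]) (simp add: algebra_simps)
qed

lemma linear_on_combination:
  assumes "bcontfun.subspace X" "linear_on bcontfun_scale s' X W T" "x \<in> X" "y \<in> X"
  shows "T (bcontfun_scale p x + bcontfun_scale q y) = s' p (T x) + s' q (T y)"
  using assms by (simp add: linear_on_def bcontfun.subspace_scale)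

lemma apply_bcontfun_combination:
  "apply_bcontfun (bcontfun_scale p x + bcontfun_scale q y) t = p * apply_bcontfun x t + q * apply_bcontfun y t"
  by (simp add: plus_bcontfun.rep_eq bcontfun_scale.rep_eq)

lemma bcontfun_scale_of_real: "bcontfun_scale (of_real r) x = r *\<^sub>R x"
  by (rule bcontfun_eqI) (simp add: bcontfun_scale.rep_eq scaleR_conv_of_real)

lemma norm_bcontfun_scale_le: "norm (bcontfun_scale c x) \<le> norm c * norm x"
  by (rule norm_bound) (simp add: bcontfun_scale.rep_eq norm_mult mult_left_mono norm_bounded)

text \<open>This covers point evaluations and the coordinates of an operator at once.\<close>

abbreviation functional_on ::
    "('a::topological_space \<Rightarrow>\<^sub>C 'k::real_normed_field) set \<Rightarrow> (('a \<Rightarrow>\<^sub>C 'k) \<Rightarrow> 'k) \<Rightarrow> bool" where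
  "functional_on X \<equiv> linear_on bcontfun_scale (*) X UNIV"

lemma functional_on_apply: "functional_on X (\<lambda>x. apply_bcontfun x t)"
  by (simp add: linear_on_def plus_bcontfun.rep_eq bcontfun_scale.rep_eq)

lemma functional_on_ell2_nth:
  assumes "linear_on bcontfun_scale ell2_scale X UNIV T"
  shows "functional_on X (\<lambda>x. ell2_nth (T x) n)"
  using assms by (simp add: linear_on_def plus_ell2.rep_eq ell2_scale.rep_eq)

text \<open>The form with \<open>sums\<close> lets coordinatewise identities pass to norms by
  uniqueness of the limit.\<close>

lemma ell2_norm_sums: "(\<lambda>n. (norm (ell2_nth a n))\<^sup>2) sums (norm a)\<^sup>2"
proof -
  have s: "summable (\<lambda>n. (norm (ell2_nth a n))\<^sup>2)" using ell2_nth[of a] by simp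
  then have "(norm a)\<^sup>2 = (\<Sum>n. (norm (ell2_nth a n))\<^sup>2)"
    by (simp add: norm_ell2.rep_eq suminf_nonneg)
  then show ?thesis using s by (simp add: summable_sums)
qed

section \<open>Two-dimensional spaces of continuous functions\<close>

text \<open>The sort of \<open>'k\<close> covers the real and the complex scalars. It also makes
  \<open>'k \<times> 'k\<close> a Euclidean space, from which compactness of the unit ball is
  drawn.\<close>

locale bcontfun_plane =
  fixes X :: "('a::metric_space \<Rightarrow>\<^sub>C 'k::{real_normed_field,euclidean_space}) set"
  assumes compact_UNIV: "compact (UNIV :: 'a set)"
    and subspace: "bcontfun.subspace X"
    and dim: "bcontfun.dim X = 2"
begin

lemma basisE:
  obtains f g where "f \<in> X" "g \<in> X" "f \<noteq> g" "bcontfun.independent {f, g}" "X \<subseteq> bcontfun.span {f, g}"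
proof -
  obtain B where "B \<subseteq> X" "bcontfun.independent B" "X \<subseteq> bcontfun.span B" "card B = 2"
    using bcontfun.basis_exists[of X] dim by auto
  then show ?thesis using that by (auto simp: card_2_iff)
qed

text \<open>By exchange: a vector outside the span would give three independent vectors in the span
  of two.\<close>

lemma independent_pair_spans:
  assumes "x1 \<in> X" "x2 \<in> X" "x1 \<noteq> x2" "bcontfun.independent {x1, x2}"
  shows "X \<subseteq> bcontfun.span {x1, x2}"
proof
  fix x assume "x \<in> X"
  obtain f g where fg: "X \<subseteq> bcontfun.span {f, g}" "f \<noteq> g" by (rule basisE)
  show "x \<in> bcontfun.span {x1, x2}"
  proof (rule ccontr)
    assume n: "x \<notin> bcontfun.span {x1, x2}"
    then have "bcontfun.independent {x, x1, x2}"
      using assms(4) by (rule bcontfun.independent_insertI)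
    then have "card {x, x1, x2} \<le> card {f, g}"
      using bcontfun.independent_span_bound[of "{f, g}"] fg \<open>x \<in> X\<close> assms by auto
    moreover have "x \<noteq> x1" "x \<noteq> x2"
      using n bcontfun.span_base by blast+
    ultimately show False using fg assms by simp
  qed
qed

text \<open>The coefficients \<open>p\<close>, \<open>q\<close>, \<open>r\<close> depend only on the
  coordinates of the \<open>u i\<close> in a basis, so one pair serves every functional.\<close>

lemma two_squares:
  assumes "\<And>i. i \<in> I \<Longrightarrow> u i \<in> X"
  obtains x1 x2 where "x1 \<in> X" "x2 \<in> X"
    "\<And>L. functional_on X L \<Longrightarrow> (\<Sum>i\<in>I. (norm (L (u i)))\<^sup>2) = (norm (L x1))\<^sup>2 + (norm (L x2))\<^sup>2"
proof -
  obtain f g where fg: "f \<in> X" "g \<in> X" "X \<subseteq> bcontfun.span {f, g}" by (rule basisE)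
  have "\<forall>i\<in>I. \<exists>a b. u i = bcontfun_scale a f + bcontfun_scale b g"
    using assms fg bcontfun_mem_span_pairE by (metis subsetD)
  then obtain a b where u: "\<And>i. i \<in> I \<Longrightarrow> u i = bcontfun_scale (a i) f + bcontfun_scale (b i) g"
    by metis
  obtain p q r :: 'k where pqr:
    "\<And>z w. (\<Sum>i\<in>I. (norm (a i * z + b i * w))\<^sup>2) = (norm (p * z + q * w))\<^sup>2 + (norm (r * w))\<^sup>2"
    by (rule gram_two_squares[where I = I and a = a and b = b]) blast
  show ?thesis
  \<comment> \<open>The zero coefficient gives the second vector the shape expected by
    \<open>linear_on_combination\<close>.\<close>
  proof (rule that[of "bcontfun_scale p f + bcontfun_scale q g" "bcontfun_scale 0 f + bcontfun_scale r g"])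
    fix L assume L: "functional_on X L"
    have "(\<Sum>i\<in>I. (norm (L (u i)))\<^sup>2) = (\<Sum>i\<in>I. (norm (a i * L f + b i * L g))\<^sup>2)"
      using u linear_on_combination[OF subspace L fg(1,2)] by (intro sum.cong) auto
    then show "(\<Sum>i\<in>I. (norm (L (u i)))\<^sup>2) = (norm (L (bcontfun_scale p f + bcontfun_scale q g)))\<^sup>2
        + (norm (L (bcontfun_scale 0 f + bcontfun_scale r g)))\<^sup>2"
      unfolding linear_on_combination[OF subspace L fg(1,2)] pqr by simp
  qed (intro bcontfun.subspace_add bcontfun.subspace_scale subspace fg)+
qed

text \<open>Coordinates in a basis give a continuous real-linear bijection \<open>\<Phi>\<close>
  from \<open>'k \<times> 'k\<close> onto \<open>X\<close>; the ball is the image of a closed set,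
  bounded because \<open>\<Phi>\<close> is bounded below.\<close>

lemma compact_unit_ball: "compact {x \<in> X. norm x \<le> 1}"
proof -
  obtain f g where fg: "f \<in> X" "g \<in> X" "f \<noteq> g" "bcontfun.independent {f, g}"
    "X \<subseteq> bcontfun.span {f, g}" by (rule basisE)
  define \<Phi> where "\<Phi> v = bcontfun_scale (fst v) f + bcontfun_scale (snd v) g" for v
  have "bounded_linear \<Phi>"
  proof
    fix v w and r :: real
    show "\<Phi> (v + w) = \<Phi> v + \<Phi> w"
      by (simp add: \<Phi>_def bcontfun.scale_left_distrib)
    show "\<Phi> (r *\<^sub>R v) = r *\<^sub>R \<Phi> v"
      by (simp add: \<Phi>_def scaleR_conv_of_real bcontfun.scale_right_distrib
          flip: bcontfun.scale_scale bcontfun_scale_of_real)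
    have "norm (\<Phi> v) \<le> norm v * (norm f + norm g)" for v
    proof -
      have "norm (\<Phi> v) \<le> norm (fst v) * norm f + norm (snd v) * norm g"
        unfolding \<Phi>_def by (intro norm_triangle_le add_mono norm_bcontfun_scale_le)
      also have "\<dots> \<le> norm v * norm f + norm v * norm g"
        by (intro add_mono mult_right_mono) (use norm_fst_le[of "fst v" "snd v"] norm_snd_le[of "snd v" "fst v"] in auto)
      finally show ?thesis by (simp add: algebra_simps)
    qed
    then show "\<exists>K. \<forall>v. norm (\<Phi> v) \<le> norm v * K" by blast
  qed
  then interpret \<Phi>: bounded_linear \<Phi> .
  have cont: "continuous_on A (\<lambda>v. norm (\<Phi> v))" for A
    by (intro continuous_intros \<Phi>.continuous_on)
  have \<Phi>0: "v = 0" if "\<Phi> v = 0" for v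
  proof -
    define u where "u h = (if h = f then fst v else snd v)" for h
    have "(\<Sum>h\<in>{f, g}. bcontfun_scale (u h) h) = 0"
      using that fg(3) by (simp add: u_def \<Phi>_def)
    then have "u h = 0" if "h \<in> {f, g}" for h
      using bcontfun.independentD[OF fg(4) _ subset_refl, of u h] that by simp
    from this[of f] this[of g] show "v = 0"
      using fg(3) by (simp add: u_def prod_eq_iff)
  qed
  have Xeq: "X = range \<Phi>"
  proof
    show "X \<subseteq> range \<Phi>"
    proof
      fix x assume "x \<in> X"
      then obtain p q where "x = bcontfun_scale p f + bcontfun_scale q g"
        using fg bcontfun_mem_span_pairE by blast
      then have "x = \<Phi> (p, q)" by (simp add: \<Phi>_def)
      then show "x \<in> range \<Phi>" by blast
    qed
    show "range \<Phi> \<subseteq> X"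
      using fg subspace by (auto simp: \<Phi>_def intro: bcontfun.subspace_add bcontfun.subspace_scale)
  qed
  \<comment> \<open>The minimum of \<open>norm (\<Phi> v)\<close> over the unit sphere is positive
    by injectivity; homogeneity extends this lower bound to all \<open>v\<close>.\<close>
  obtain v0 :: "'k \<times> 'k" where v0: "norm v0 = 1" "\<And>v. norm v = 1 \<Longrightarrow> norm (\<Phi> v0) \<le> norm (\<Phi> v)"
  proof -
    have "sphere (0 :: 'k \<times> 'k) 1 \<noteq> {}" by simp
    from continuous_attains_inf[OF compact_sphere this cont] show ?thesis
      using that by auto
  qed
  have m: "norm (\<Phi> v0) > 0" using v0 \<Phi>0[of v0] by auto
  have below: "norm v \<le> norm (\<Phi> v) / norm (\<Phi> v0)" for v
  proof (cases "v = 0")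
    case False
    then have "norm (\<Phi> v0) \<le> norm (\<Phi> (v /\<^sub>R norm v))" by (intro v0) simp
    then show ?thesis using False m by (simp add: \<Phi>.scaleR field_simps)
  qed (simp add: \<Phi>.zero)
  have "bounded {v. norm (\<Phi> v) \<le> 1}"
    unfolding bounded_iff
  proof (intro exI ballI)
    fix v assume "v \<in> {v. norm (\<Phi> v) \<le> 1}"
    then show "norm v \<le> 1 / norm (\<Phi> v0)"
      using below[of v] m by (simp add: field_simps)
  qed
  moreover have "closed {v. norm (\<Phi> v) \<le> 1}"
    by (intro closed_Collect_le cont continuous_intros)
  ultimately have "compact {v. norm (\<Phi> v) \<le> 1}" by (simp add: compact_eq_bounded_closed)
  then have "compact (\<Phi> ` {v. norm (\<Phi> v) \<le> 1})"
    by (intro compact_continuous_image \<Phi>.continuous_on continuous_on_id)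
  also have "\<Phi> ` {v. norm (\<Phi> v) \<le> 1} = {x \<in> X. norm x \<le> 1}"
    unfolding Xeq by auto
  finally show ?thesis .
qed

end

section \<open>Coordinates in the sequence space and linear maps on its finite sections\<close>

lemma ell2_norm_fin:
  assumes "a \<in> ell2_fin n"
  shows "(norm a)\<^sup>2 = (\<Sum>i<n. (norm (ell2_nth a i))\<^sup>2)"
proof (rule sums_unique2[OF ell2_norm_sums sums_finite])
  show "(norm (ell2_nth a i))\<^sup>2 = 0" if "i \<notin> {..<n}" for i
    using assms that by (simp add: ell2_fin_def)
qed simp

lemma ell2_sum_coord_le: "finite I \<Longrightarrow> (\<Sum>i\<in>I. (norm (ell2_nth a i))\<^sup>2) \<le> (norm a)\<^sup>2"
  using sum_le_suminf[OF sums_summable[OF ell2_norm_sums[of a]], of I] sums_unique[OF ell2_norm_sums[of a]]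
  by simp

lemma ell2_scale_1: "ell2_scale 1 a = a"
  by (simp add: ell2_nth_inject[symmetric] ell2_scale.rep_eq)

lemma ell2_scale_minus_1: "ell2_scale (- 1) a = - a"
  by (simp add: ell2_nth_inject[symmetric] ell2_scale.rep_eq uminus_ell2.rep_eq)

lemma ell2_scale_0: "ell2_scale 0 a = 0"
  by (simp add: ell2_nth_inject[symmetric] ell2_scale.rep_eq zero_ell2.rep_eq)

lemma ell2_nth_unit_combination:
  "ell2_nth (\<Sum>i<n. ell2_scale (c i) (ell2_unit i)) m = (if m < n then c m else 0)"
  by (induction n)
     (auto simp: zero_ell2.rep_eq plus_ell2.rep_eq ell2_scale.rep_eq ell2_unit.rep_eq less_Suc_eq)

text \<open>The induction runs over the number \<open>m\<close> of terms with \<open>n\<close>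
  fixed, since \<open>U\<close> is linear only on \<open>ell2_fin n\<close> and all partial sums
  must stay there.\<close>

lemma linear_on_unit_combination:
  assumes U: "linear_on ell2_scale bcontfun_scale (ell2_fin n) X U" and "m \<le> n"
  shows "U (\<Sum>i<m. ell2_scale (c i) (ell2_unit i)) = (\<Sum>i<m. bcontfun_scale (c i) (U (ell2_unit i)))"
  using \<open>m \<le> n\<close>
proof (induction m)
  case 0
  have "(0 :: 'a ell2) \<in> ell2_fin n" by (simp add: ell2_fin_def zero_ell2.rep_eq)
  then have "U (ell2_scale 0 0) = bcontfun_scale 0 (U 0)"
    using U by (simp add: linear_on_def)
  then show ?case by (simp add: ell2_scale_0)
next
  case (Suc m)
  have "(\<Sum>i<m. ell2_scale (c i) (ell2_unit i)) \<in> ell2_fin n" "(ell2_unit m :: 'a ell2) \<in> ell2_fin n"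
    "ell2_scale (c m) (ell2_unit m) \<in> ell2_fin n"
    using Suc.prems
    by (auto simp: ell2_fin_def ell2_nth_unit_combination ell2_unit.rep_eq ell2_scale.rep_eq)
  then show ?case
    using U Suc by (simp add: linear_on_def)
qed

section \<open>The 2-summing norm as a maximum over pairs\<close>

lemma opnorm_on_le_1_iff:
  "opnorm_on V T \<le> 1 \<longleftrightarrow> (\<forall>x\<in>V. norm x \<le> 1 \<longrightarrow> norm (T x) \<le> 1)"
  by (auto simp: opnorm_on_def SUP_le_iff)

lemma norm_le_opnorm_on: "x \<in> V \<Longrightarrow> norm x \<le> 1 \<Longrightarrow> ennreal (norm (T x)) \<le> opnorm_on V T"
  unfolding opnorm_on_def by (rule SUP_upper) simp

text \<open>Evaluation at \<open>t\<close> after \<open>U\<close> is a functional of norm at most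
  one on \<open>ell2_fin n\<close>, and the sum is the square of its norm.\<close>

lemma coordinate_square_sum_le:
  fixes U :: "'k::{real_normed_field,real_inner} ell2 \<Rightarrow> ('a::topological_space \<Rightarrow>\<^sub>C 'k)"
  assumes U: "linear_on ell2_scale bcontfun_scale (ell2_fin n) X U"
    and op: "opnorm_on (ell2_fin n) U \<le> 1"
  shows "(\<Sum>i<n. (norm (apply_bcontfun (U (ell2_unit i)) t))\<^sup>2) \<le> 1"
proof -
  define u where "u i = apply_bcontfun (U (ell2_unit i)) t" for i
  define R where "R = (\<Sum>i<n. (norm (u i))\<^sup>2)"
  have "R \<ge> 0" by (simp add: R_def sum_nonneg)
  have "R \<le> 1"
  proof (cases "R = 0")
    case False
    with \<open>R \<ge> 0\<close> have "R > 0" by simp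
    \<comment> \<open>The extremal vector for Cauchy-Schwarz, normalised to length one:
      \<open>U a\<close> has the value \<open>sqrt R\<close> at \<open>t\<close>.\<close>
    define c where "c i = adj (u i) / of_real (sqrt R)" for i
    define a where "a = (\<Sum>i<n. ell2_scale (c i) (ell2_unit i))"
    have a: "a \<in> ell2_fin n" by (simp add: ell2_fin_def a_def ell2_nth_unit_combination)
    have "(norm a)\<^sup>2 = (\<Sum>i<n. (norm (u i))\<^sup>2 / R)"
      unfolding ell2_norm_fin[OF a]
      using \<open>R > 0\<close> by (simp add: a_def ell2_nth_unit_combination c_def norm_divide power_divide)
    also have "\<dots> = 1" using \<open>R > 0\<close> by (simp add: R_def flip: sum_divide_distrib)
    finally have "norm a = 1" using norm_ge_zero[of a] unfolding power2_eq_1_iff by linarith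
    with op a have 1: "norm (U a) \<le> 1" by (simp add: opnorm_on_le_1_iff)
    have "apply_bcontfun (\<Sum>i\<in>I. F i) t = (\<Sum>i\<in>I. apply_bcontfun (F i) t)" for F :: "nat \<Rightarrow> ('a \<Rightarrow>\<^sub>C 'k)" and I
      by (induction I rule: infinite_finite_induct) (auto simp: plus_bcontfun.rep_eq)
    then have "apply_bcontfun (U a) t = (\<Sum>i<n. c i * u i)"
      by (simp add: a_def linear_on_unit_combination[OF U] u_def bcontfun_scale.rep_eq)
    also have "\<dots> = (\<Sum>i<n. of_real ((norm (u i))\<^sup>2 / sqrt R))"
      by (intro sum.cong) (simp_all add: c_def mult_adj mult.commute[of _ "u _"])
    also have "\<dots> = of_real (R / sqrt R)"
      by (simp only: R_def of_real_sum sum_divide_distrib)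
    also have "R / sqrt R = sqrt R" using \<open>R > 0\<close> by (simp add: real_div_sqrt)
    finally have "norm (apply_bcontfun (U a) t) = sqrt R" using \<open>R > 0\<close> by simp
    with norm_bounded[of "U a" t] 1 have "sqrt R \<le> 1" by linarith
    then show ?thesis by simp
  qed simp
  then show ?thesis by (simp add: R_def u_def)
qed

lemma norm_combination_le:
  fixes a b z w :: "'k::real_normed_field"
  assumes "(norm z)\<^sup>2 + (norm w)\<^sup>2 \<le> 1"
  shows "norm (a * z + b * w) \<le> sqrt ((norm a)\<^sup>2 + (norm b)\<^sup>2)"
proof (rule real_le_rsqrt)
  have "norm (a * z + b * w) \<le> norm a * norm z + norm b * norm w"
    by (rule norm_triangle_le) (simp add: norm_mult)
  then have "(norm (a * z + b * w))\<^sup>2 \<le> (norm a * norm z + norm b * norm w)\<^sup>2"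
    by (intro power_mono) auto
  also have "\<dots> \<le> ((norm a)\<^sup>2 + (norm b)\<^sup>2) * ((norm z)\<^sup>2 + (norm w)\<^sup>2)"
    \<comment> \<open>By Lagrange's identity this square is the difference of the two sides.\<close>
    using zero_le_power2[of "norm a * norm w - norm b * norm z"]
    by (simp add: power2_eq_square algebra_simps)
  also have "\<dots> \<le> ((norm a)\<^sup>2 + (norm b)\<^sup>2) * 1"
    using assms by (intro mult_left_mono) auto
  finally show "(norm (a * z + b * w))\<^sup>2 \<le> (norm a)\<^sup>2 + (norm b)\<^sup>2" by simp
qed

text \<open>These are the pairs of images of the two unit vectors under operators of norm at most
  one from two-dimensional Hilbert space into the bounded continuous functions.\<close>

definition square_bounded :: "('a::topological_space \<Rightarrow>\<^sub>C 'k::real_normed_field) \<Rightarrow> ('a \<Rightarrow>\<^sub>C 'k) \<Rightarrow> bool" where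
  "square_bounded x1 x2 \<longleftrightarrow> (\<forall>t. (norm (apply_bcontfun x1 t))\<^sup>2 + (norm (apply_bcontfun x2 t))\<^sup>2 \<le> 1)"

lemma square_bounded_norm_le: "square_bounded x1 x2 \<Longrightarrow> norm x1 \<le> 1"
proof (rule norm_bound)
  fix t assume "square_bounded x1 x2"
  then have "(norm (apply_bcontfun x1 t))\<^sup>2 + (norm (apply_bcontfun x2 t))\<^sup>2 \<le> 1"
    by (simp add: square_bounded_def)
  then have "(norm (apply_bcontfun x1 t))\<^sup>2 \<le> 1\<^sup>2"
    using zero_le_power2[of "norm (apply_bcontfun x2 t)"] unfolding one_power2 by linarith
  then show "norm (apply_bcontfun x1 t) \<le> 1" by (rule power2_le_imp_le) simp
qed

lemma square_bounded_commute: "square_bounded x1 x2 \<longleftrightarrow> square_bounded x2 x1"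
  by (simp add: square_bounded_def add.commute)

lemma square_bounded_0: "norm x \<le> 1 \<Longrightarrow> square_bounded x 0"
  unfolding square_bounded_def by (simp add: power_le_one order_trans[OF norm_bounded])

text \<open>The pair defines an operator of norm at most one on \<open>ell2_fin 2\<close> that sends
  the unit vectors to \<open>x1\<close> and \<open>x2\<close>, so it competes in the
  supremum.\<close>

lemma pi2_ge:
  fixes X :: "('a::topological_space \<Rightarrow>\<^sub>C 'k::real_normed_field) set"
  assumes X: "bcontfun.subspace X" and x: "x1 \<in> X" "x2 \<in> X" "square_bounded x1 x2"
  shows "ennreal (sqrt ((norm (T x1))\<^sup>2 + (norm (T x2))\<^sup>2)) \<le> pi2 bcontfun_scale X T"
proof -
  define U where "U a = bcontfun_scale (ell2_nth a 0) x1 + bcontfun_scale (ell2_nth a 1) x2" for a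
  have nU: "norm (U a) \<le> norm a" for a
  proof (rule norm_bound)
    fix t
    have "norm (apply_bcontfun (U a) t) \<le> sqrt ((norm (ell2_nth a 0))\<^sup>2 + (norm (ell2_nth a 1))\<^sup>2)"
      unfolding U_def apply_bcontfun_combination
      by (rule norm_combination_le) (use x in \<open>simp add: square_bounded_def\<close>)
    also have "\<dots> \<le> norm a"
      using ell2_sum_coord_le[of "{0, 1}" a] by (intro real_le_lsqrt) auto
    finally show "norm (apply_bcontfun (U a) t) \<le> norm a" .
  qed
  have "linear_on ell2_scale bcontfun_scale (ell2_fin 2) X U"
    using X x
    by (auto simp: linear_on_def U_def plus_ell2.rep_eq ell2_scale.rep_eq bcontfun.scale_left_distrib
        bcontfun.scale_right_distrib intro: bcontfun.subspace_add bcontfun.subspace_scale)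
  moreover have "\<exists>B. \<forall>a\<in>ell2_fin 2. norm (U a) \<le> norm a * B"
    using nU by (intro exI[of _ 1]) simp
  moreover have "opnorm_on (ell2_fin 2) U \<le> 1"
    using nU by (force simp: opnorm_on_le_1_iff intro: order_trans[OF nU])
  ultimately have "ennreal (sqrt (\<Sum>i<2. (norm (T (U (ell2_unit i))))\<^sup>2)) \<le> pi2 bcontfun_scale X T"
    unfolding pi2_def bounded_linear_on_def
    by (intro SUP_upper2[of "(2, U)"]) auto
  moreover have "U (ell2_unit 0) = x1" "U (ell2_unit 1) = x2"
    by (simp_all add: U_def ell2_unit.rep_eq)
  ultimately show ?thesis by (simp add: numeral_2_eq_2)
qed

lemma opnorm_on_le_pi2:
  fixes X :: "('a::topological_space \<Rightarrow>\<^sub>C 'k::real_normed_field) set"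
  assumes "bcontfun.subspace X"
  shows "opnorm_on X T \<le> pi2 bcontfun_scale X T"
  unfolding opnorm_on_def
proof (rule SUP_least)
  fix x assume x: "x \<in> {x \<in> X. norm x \<le> 1}"
  \<comment> \<open>The pair of \<open>x\<close> and \<open>0\<close> is square-bounded; the term
    with \<open>T 0\<close> can only increase the bound.\<close>
  have "ennreal (norm (T x)) \<le> ennreal (sqrt ((norm (T x))\<^sup>2 + (norm (T 0))\<^sup>2))"
    by (intro ennreal_leI real_le_rsqrt) simp
  also have "\<dots> \<le> pi2 bcontfun_scale X T"
    using x assms by (intro pi2_ge square_bounded_0 bcontfun.subspace_0) auto
  finally show "ennreal (norm (T x)) \<le> pi2 bcontfun_scale X T" .
qed

lemma bounded_linear_on_continuous_norm:
  fixes X :: "('a::topological_space \<Rightarrow>\<^sub>C 'k::real_normed_field) set"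
  assumes X: "bcontfun.subspace X" and T: "bounded_linear_on bcontfun_scale ell2_scale X UNIV T"
  shows "continuous_on X (\<lambda>x. norm (T x))"
proof -
  obtain B where B: "\<And>x. x \<in> X \<Longrightarrow> norm (T x) \<le> norm x * B"
    and lin: "linear_on bcontfun_scale ell2_scale X UNIV T"
    using T unfolding bounded_linear_on_def by blast
  \<comment> \<open>A Lipschitz constant must be nonnegative, whereas \<open>B\<close> may be
    negative if \<open>X\<close> is trivial; hence \<open>max B 0\<close>.\<close>
  have "\<bar>norm (T x) - norm (T y)\<bar> \<le> max B 0 * norm (x - y)" if "x \<in> X" "y \<in> X" for x y
  proof -
    have "T (x - y) = T x - T y"
      using linear_on_combination[OF X lin that, of 1 "-1"]
      by (simp add: ell2_scale_1 ell2_scale_minus_1)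
    then have "\<bar>norm (T x) - norm (T y)\<bar> \<le> norm (T (x - y))"
      by (simp add: norm_triangle_ineq3)
    also have "\<dots> \<le> norm (x - y) * B"
      using that by (intro B bcontfun.subspace_diff X)
    also have "\<dots> \<le> max B 0 * norm (x - y)"
      by (simp add: mult.commute mult_right_mono)
    finally show ?thesis .
  qed
  then have "(max B 0)-lipschitz_on X (\<lambda>x. norm (T x))"
    by (intro lipschitz_onI) (auto simp: dist_norm)
  then show ?thesis by (rule lipschitz_on_continuous_on)
qed

context bcontfun_plane
begin

text \<open>The coordinates of \<open>T\<close> are functionals, so the identity of
  \<open>two_squares\<close> holds in each of them and can be summed over all coordinates.\<close>

lemma two_squares_operator:
  assumes T: "linear_on bcontfun_scale ell2_scale X UNIV T"
    and u: "\<And>i. i \<in> I \<Longrightarrow> u i \<in> X"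
  shows "\<exists>x1\<in>X. \<exists>x2\<in>X.
    (\<forall>t. (\<Sum>i\<in>I. (norm (apply_bcontfun (u i) t))\<^sup>2)
       = (norm (apply_bcontfun x1 t))\<^sup>2 + (norm (apply_bcontfun x2 t))\<^sup>2) \<and>
    (\<Sum>i\<in>I. (norm (T (u i)))\<^sup>2) = (norm (T x1))\<^sup>2 + (norm (T x2))\<^sup>2"
proof -
  obtain x1 x2 where x: "x1 \<in> X" "x2 \<in> X"
    and L: "\<And>L. functional_on X L \<Longrightarrow> (\<Sum>i\<in>I. (norm (L (u i)))\<^sup>2) = (norm (L x1))\<^sup>2 + (norm (L x2))\<^sup>2"
    using two_squares[of I u] u by metis
  have "(\<lambda>n. \<Sum>i\<in>I. (norm (ell2_nth (T (u i)) n))\<^sup>2) sums (\<Sum>i\<in>I. (norm (T (u i)))\<^sup>2)"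
    by (intro sums_sum ell2_norm_sums)
  then have "(\<Sum>i\<in>I. (norm (T (u i)))\<^sup>2) = (norm (T x1))\<^sup>2 + (norm (T x2))\<^sup>2"
    unfolding L[OF functional_on_ell2_nth[OF T]]
    by (rule sums_unique2) (intro sums_add ell2_norm_sums)
  then show ?thesis using x L[OF functional_on_apply] by blast
qed

text \<open>The vectors \<open>U (ell2_unit i)\<close> are replaced by one pair in \<open>X\<close>
  with the same pointwise square sum and the same square sum after \<open>T\<close>; the former
  makes the pair square-bounded.\<close>

lemma pi2_le:
  assumes T: "bounded_linear_on bcontfun_scale ell2_scale X UNIV T"
    and M: "\<And>x1 x2. x1 \<in> X \<Longrightarrow> x2 \<in> X \<Longrightarrow> square_bounded x1 x2 \<Longrightarrow> (norm (T x1))\<^sup>2 + (norm (T x2))\<^sup>2 \<le> M"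
  shows "pi2 bcontfun_scale X T \<le> ennreal (sqrt M)"
  unfolding pi2_def
proof (rule SUP_least, clarify)
  fix n :: nat and U :: "'k ell2 \<Rightarrow> ('a \<Rightarrow>\<^sub>C 'k)"
  assume U: "bounded_linear_on ell2_scale bcontfun_scale (ell2_fin n) X U" and op: "opnorm_on (ell2_fin n) U \<le> 1"
  then have Ul: "linear_on ell2_scale bcontfun_scale (ell2_fin n) X U" by (simp add: bounded_linear_on_def)
  have Tl: "linear_on bcontfun_scale ell2_scale X UNIV T" using T by (simp add: bounded_linear_on_def)
  have UX: "U (ell2_unit i) \<in> X" if "i \<in> {..<n}" for i
    using Ul that by (auto simp: linear_on_def ell2_fin_def ell2_unit.rep_eq)
  obtain x1 x2 where x: "x1 \<in> X" "x2 \<in> X"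
    "\<And>t. (\<Sum>i<n. (norm (apply_bcontfun (U (ell2_unit i)) t))\<^sup>2)
       = (norm (apply_bcontfun x1 t))\<^sup>2 + (norm (apply_bcontfun x2 t))\<^sup>2"
    "(\<Sum>i<n. (norm (T (U (ell2_unit i))))\<^sup>2) = (norm (T x1))\<^sup>2 + (norm (T x2))\<^sup>2"
    using two_squares_operator[where I = "{..<n}" and u = "\<lambda>i. U (ell2_unit i)", OF Tl UX] by blast
  then have "square_bounded x1 x2"
    using coordinate_square_sum_le[OF Ul op] by (simp add: square_bounded_def)
  then show "ennreal (sqrt (\<Sum>i<n. (norm (T (U (ell2_unit i))))\<^sup>2)) \<le> ennreal (sqrt M)"
    unfolding x(4) by (intro ennreal_leI real_sqrt_le_mono M x)
qed

end

lemma continuous_on_evaluation: "continuous_on A (\<lambda>x. apply_bcontfun x t)"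
  for A :: "('a::topological_space \<Rightarrow>\<^sub>C 'k::real_normed_vector) set"
proof (rule lipschitz_on_continuous_on)
  show "1-lipschitz_on A (\<lambda>x. apply_bcontfun x t)"
    using dist_bounded by (auto intro!: lipschitz_onI)
qed

lemma norm_ell2_scale: "norm (ell2_scale c a) = norm c * norm a"
proof -
  have "(norm (ell2_scale c a))\<^sup>2 = (norm c * norm a)\<^sup>2"
    using sums_unique2[OF ell2_norm_sums[of "ell2_scale c a"]] sums_mult[OF ell2_norm_sums[of a], of "(norm c)\<^sup>2"]
    by (simp add: ell2_scale.rep_eq norm_mult power_mult_distrib)
  then show ?thesis by simp
qed

section \<open>Operators on which the two norms differ\<close>

context bcontfun_plane
begin

section \<open>From a witness to a strict inequality of norms\<close>

lemma unit_vectorE: obtains x where "x \<in> X" "norm x = 1"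
proof -
  obtain f g where f: "f \<in> X" "bcontfun.independent {f, g}" by (rule basisE)
  then have "f \<noteq> 0" using bcontfun.dependent_zero by blast
  then show ?thesis
    using f subspace
    by (intro that[of "bcontfun_scale (of_real (inverse (norm f))) f"] bcontfun.subspace_scale)
       (simp_all only: bcontfun_scale_of_real, simp)
qed

lemma not_two_summing_if_witness:
  assumes x: "x1 \<in> X" "x2 \<in> X" "square_bounded x1 x2"
    and K0: "\<And>t. t \<in> K0 \<Longrightarrow> 1 \<le> (norm (apply_bcontfun x1 t))\<^sup>2 + (norm (apply_bcontfun x2 t))\<^sup>2"
    and no_unimodular: "\<And>x. x \<in> X \<Longrightarrow> norm x = 1 \<Longrightarrow> \<exists>t\<in>K0. norm (apply_bcontfun x t) \<noteq> 1"
  shows "\<not> two_summing_property bcontfun_scale X"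
proof
  assume two_summing: "two_summing_property bcontfun_scale X"
  define B where "B = {x \<in> X. norm x \<le> 1}"
  have "compact B" unfolding B_def by (rule compact_unit_ball)
  have "0 \<in> B" using subspace by (simp add: B_def bcontfun.subspace_0)
  \<comment> \<open>On an empty \<open>K0\<close> any unit vector would be unimodular
    vacuously.\<close>
  have "K0 \<noteq> {}" using unit_vectorE no_unimodular by (metis empty_iff)
  \<comment> \<open>If \<open>x\<close> in the ball had modulus at least one on \<open>K0\<close>,
    then \<open>norm x = 1\<close> and \<open>x\<close> would be unimodular on
    \<open>K0\<close>.\<close>
  have "B \<subseteq> (\<Union>t\<in>K0. {x. norm (apply_bcontfun x t) < 1})"
  proof
    fix x assume "x \<in> B"
    show "x \<in> (\<Union>t\<in>K0. {x. norm (apply_bcontfun x t) < 1})"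
    proof (rule ccontr)
      assume "x \<notin> (\<Union>t\<in>K0. {x. norm (apply_bcontfun x t) < 1})"
      then have ge: "norm (apply_bcontfun x t) \<ge> 1" if "t \<in> K0" for t using that by auto
      moreover have le: "norm (apply_bcontfun x t) \<le> norm x" "norm x \<le> 1" for t
        using \<open>x \<in> B\<close> norm_bounded by (auto simp: B_def)
      ultimately have "norm x = 1" using \<open>K0 \<noteq> {}\<close> by (metis all_not_in_conv order_antisym order_trans)
      then show False
        using no_unimodular[of x] ge le \<open>x \<in> B\<close> unfolding B_def by (metis (mono_tags, lifting) mem_Collect_eq order_antisym)
    qed
  qed
  moreover have "open {x :: 'a \<Rightarrow>\<^sub>C 'k. norm (apply_bcontfun x t) < 1}" for t
    by (intro open_Collect_less continuous_intros continuous_on_evaluation)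
  ultimately obtain P where P: "P \<subseteq> K0" "finite P" "B \<subseteq> (\<Union>t\<in>P. {x. norm (apply_bcontfun x t) < 1})"
    using compactE_image[OF \<open>compact B\<close>] by (metis (no_types, lifting))
  define m where "m = card P"
  obtain \<tau> where \<tau>: "bij_betw \<tau> {..<m} P"
    using ex_bij_betw_nat_finite[OF \<open>finite P\<close>] by (auto simp: m_def atLeast0LessThan)
  \<comment> \<open>The values on \<open>P\<close>, enumerated by \<open>\<tau>\<close> and padded
    with zeros to a square-summable sequence.\<close>
  define T where "T x = Abs_ell2 (\<lambda>i. if i < m then apply_bcontfun x (\<tau> i) else 0)" for x :: "'a \<Rightarrow>\<^sub>C 'k"
  have nth_T: "ell2_nth (T x) = (\<lambda>i. if i < m then apply_bcontfun x (\<tau> i) else 0)" for x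
    unfolding T_def by (rule Abs_ell2_inverse) (auto intro!: summable_finite[of "{..<m}"] split: if_splits)
  have norm_T: "(norm (T x))\<^sup>2 = (\<Sum>t\<in>P. (norm (apply_bcontfun x t))\<^sup>2)" for x
  proof -
    have "(norm (T x))\<^sup>2 = (\<Sum>i<m. (norm (apply_bcontfun x (\<tau> i)))\<^sup>2)"
      by (subst ell2_norm_fin[of _ m]) (auto simp: ell2_fin_def nth_T)
    also have "\<dots> = (\<Sum>t\<in>P. (norm (apply_bcontfun x t))\<^sup>2)"
      using \<tau> by (rule sum.reindex_bij_betw)
    finally show ?thesis .
  qed
  have "linear_on bcontfun_scale ell2_scale X UNIV T"
    by (auto simp: linear_on_def ell2_nth_inject[symmetric] nth_T plus_ell2.rep_eq ell2_scale.rep_eq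
        plus_bcontfun.rep_eq bcontfun_scale.rep_eq fun_eq_iff)
  moreover have "norm (T x) \<le> norm x * sqrt m" for x
  proof (rule power2_le_imp_le)
    have "(norm (T x))\<^sup>2 \<le> (\<Sum>t\<in>P. (norm x)\<^sup>2)"
      unfolding norm_T by (intro sum_mono power_mono norm_bounded) auto
    then show "(norm (T x))\<^sup>2 \<le> (norm x * sqrt m)\<^sup>2"
      by (simp add: m_def power_mult_distrib mult.commute)
  qed simp
  ultimately have T: "bounded_linear_on bcontfun_scale ell2_scale X UNIV T"
    unfolding bounded_linear_on_def by blast
  have less: "(norm (T x))\<^sup>2 < m" if xB: "x \<in> B" for x
  proof -
    have "(\<Sum>t\<in>P. (norm (apply_bcontfun x t))\<^sup>2) < (\<Sum>t\<in>P. 1)"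
    proof (rule sum_strict_mono_ex1)
      show "\<forall>t\<in>P. (norm (apply_bcontfun x t))\<^sup>2 \<le> 1"
        using that by (auto simp: B_def intro!: power_le_one order_trans[OF norm_bounded])
      obtain t where "t \<in> P" "norm (apply_bcontfun x t) < 1" using xB P(3) by auto
      then show "\<exists>t\<in>P. (norm (apply_bcontfun x t))\<^sup>2 < 1"
        by (auto simp: power_less_one_iff)
    qed (rule P)
    then show ?thesis by (simp add: norm_T m_def)
  qed
  \<comment> \<open>The supremum over the compact ball is attained, so the strict bound
    \<open>less\<close> passes to the operator norm.\<close>
  have "continuous_on B (\<lambda>x. norm (T x))"
    using bounded_linear_on_continuous_norm[OF subspace T] by (rule continuous_on_subset) (auto simp: B_def)
  then obtain x0 where x0: "x0 \<in> B" "\<And>x. x \<in> B \<Longrightarrow> norm (T x) \<le> norm (T x0)"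
    using continuous_attains_sup[OF \<open>compact B\<close>] \<open>0 \<in> B\<close> by blast
  have "opnorm_on X T \<le> ennreal (norm (T x0))"
    unfolding opnorm_on_def using x0 by (intro SUP_least ennreal_leI) (simp add: B_def)
  also have "\<dots> < ennreal (sqrt m)"
    using less[OF x0(1)] by (simp add: ennreal_less_iff real_less_rsqrt)
  also have "\<dots> \<le> ennreal (sqrt ((norm (T x1))\<^sup>2 + (norm (T x2))\<^sup>2))"
  proof (intro ennreal_leI real_sqrt_le_mono)
    have "(\<Sum>t\<in>P. 1) \<le> (\<Sum>t\<in>P. (norm (apply_bcontfun x1 t))\<^sup>2 + (norm (apply_bcontfun x2 t))\<^sup>2)"
      using K0 P(1) by (intro sum_mono) auto
    then show "real m \<le> (norm (T x1))\<^sup>2 + (norm (T x2))\<^sup>2"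
      by (simp add: norm_T m_def sum.distrib)
  qed
  also have "\<dots> \<le> pi2 bcontfun_scale X T"
    by (intro pi2_ge subspace x)
  finally show False
    using two_summing T unfolding two_summing_property_def by (metis less_irrefl)
qed

section \<open>From a strict inequality of norms to a witness\<close>

lemma compact_square_bounded: "compact {z \<in> X \<times> X. square_bounded (fst z) (snd z)}"
proof -
  let ?B = "{x \<in> X. norm x \<le> 1}"
  let ?C = "\<Inter>t. {z :: ('a \<Rightarrow>\<^sub>C 'k) \<times> ('a \<Rightarrow>\<^sub>C 'k).
    (norm (apply_bcontfun (fst z) t))\<^sup>2 + (norm (apply_bcontfun (snd z) t))\<^sup>2 \<le> 1}"
  have "closed ?C"
    by (intro closed_INT ballI closed_Collect_le continuous_intros
        continuous_on_compose2[OF continuous_on_evaluation[of UNIV]]) auto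
  have C: "?C = {z. square_bounded (fst z) (snd z)}"
    by (auto simp: square_bounded_def)
  have "compact ((?B \<times> ?B) \<inter> ?C)"
    using \<open>closed ?C\<close>
    by (intro compact_Int_closed compact_Times compact_unit_ball)
  also have "(?B \<times> ?B) \<inter> ?C = {z \<in> X \<times> X. square_bounded (fst z) (snd z)}"
    unfolding C
    by (auto dest: square_bounded_norm_le square_bounded_norm_le[OF square_bounded_commute[THEN iffD1]])
  finally show ?thesis .
qed

text \<open>Both vectors are multiples \<open>c\<close>, \<open>d\<close> of one vector
  \<open>y\<close>, and a single multiple \<open>e\<close> of \<open>y\<close> carries the same
  square sum. This excludes dependent maximising pairs.\<close>

lemma dependent_pair_one_square:
  assumes x: "x1 \<in> X" "x2 \<in> X" "square_bounded x1 x2"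
    and dep: "\<not> (x1 \<noteq> x2 \<and> bcontfun.independent {x1, x2})"
    and T: "linear_on bcontfun_scale ell2_scale X UNIV T"
  obtains x where "x \<in> X" "norm x \<le> 1" "(norm (T x))\<^sup>2 = (norm (T x1))\<^sup>2 + (norm (T x2))\<^sup>2"
proof -
  obtain y c d where y: "y \<in> X" "x1 = bcontfun_scale c y" "x2 = bcontfun_scale d y"
  proof (cases "x1 \<in> bcontfun.span {x2}")
    case True
    then obtain c where "x1 = bcontfun_scale c x2"
      by (auto simp: bcontfun.span_singleton)
    then show ?thesis using that[of x2 c 1] x by simp
  next
    case False
    then have "x1 \<noteq> x2" using bcontfun.span_base by blast
    \<comment> \<open>As \<open>x1\<close> lies outside the span of \<open>x2\<close>, the
      dependence can only come from the singleton of \<open>x2\<close>.\<close>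
    with False dep have "x2 = 0"
      by (auto simp: bcontfun.independent_insert)
    then show ?thesis using that[of x1 1 0] x by simp
  qed
  define e :: 'k where "e = of_real (sqrt ((norm c)\<^sup>2 + (norm d)\<^sup>2))"
  have e: "(norm e)\<^sup>2 = (norm c)\<^sup>2 + (norm d)\<^sup>2" by (simp add: e_def)
  have Ts: "T (bcontfun_scale r y) = ell2_scale r (T y)" for r
    using T y by (simp add: linear_on_def)
  show ?thesis
  proof (rule that[of "bcontfun_scale e y"])
    show "bcontfun_scale e y \<in> X" using y subspace by (simp add: bcontfun.subspace_scale)
    have "square_bounded (bcontfun_scale e y) 0"
      using x(3) by (simp add: square_bounded_def y bcontfun_scale.rep_eq norm_mult power_mult_distrib e algebra_simps)
    then show "norm (bcontfun_scale e y) \<le> 1" by (rule square_bounded_norm_le)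
    show "(norm (T (bcontfun_scale e y)))\<^sup>2 = (norm (T x1))\<^sup>2 + (norm (T x2))\<^sup>2"
      by (simp add: y Ts norm_ell2_scale power_mult_distrib e algebra_simps)
  qed
qed

text \<open>With \<open>A\<close> the form of the pair and \<open>B\<close> that of
  \<open>x\<close>, the bound on \<open>s\<close> makes \<open>\<mu> A - s B\<close> positive, so it
  comes from a pair; the same pair serves point evaluations and the coordinates of
  \<open>T\<close>.\<close>

lemma perturbed_pair:
  assumes x: "x1 \<in> X" "x2 \<in> X" and T: "linear_on bcontfun_scale ell2_scale X UNIV T"
    and s: "s \<ge> 0" "s * ((norm c)\<^sup>2 + (norm d)\<^sup>2) \<le> \<mu>"
    and x_def: "x = bcontfun_scale c x1 + bcontfun_scale d x2"
  shows "\<exists>y1\<in>X. \<exists>y2\<in>X.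
    (\<forall>t. (norm (apply_bcontfun y1 t))\<^sup>2 + (norm (apply_bcontfun y2 t))\<^sup>2
       = \<mu> * ((norm (apply_bcontfun x1 t))\<^sup>2 + (norm (apply_bcontfun x2 t))\<^sup>2) - s * (norm (apply_bcontfun x t))\<^sup>2) \<and>
    (norm (T y1))\<^sup>2 + (norm (T y2))\<^sup>2 = \<mu> * ((norm (T x1))\<^sup>2 + (norm (T x2))\<^sup>2) - s * (norm (T x))\<^sup>2"
proof -
  obtain p q r :: 'k where pqr: "\<And>z w. (norm (p * z + q * w))\<^sup>2 + (norm (r * w))\<^sup>2
       = \<mu> * ((norm z)\<^sup>2 + (norm w)\<^sup>2) - s * (norm (c * z + d * w))\<^sup>2"
    by (rule perturbed_form_two_squares[OF s]) blast
  define y1 where "y1 = bcontfun_scale p x1 + bcontfun_scale q x2"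
  define y2 where "y2 = bcontfun_scale 0 x1 + bcontfun_scale r x2"
  have L: "(norm (L y1))\<^sup>2 + (norm (L y2))\<^sup>2
    = \<mu> * ((norm (L x1))\<^sup>2 + (norm (L x2))\<^sup>2) - s * (norm (L x))\<^sup>2" if "functional_on X L" for L
    unfolding y1_def y2_def x_def linear_on_combination[OF subspace that x] using pqr by simp
  have "(\<lambda>n. (norm (ell2_nth (T y1) n))\<^sup>2 + (norm (ell2_nth (T y2) n))\<^sup>2)
      sums ((norm (T y1))\<^sup>2 + (norm (T y2))\<^sup>2)"
    by (intro sums_add ell2_norm_sums)
  then have "(norm (T y1))\<^sup>2 + (norm (T y2))\<^sup>2 = \<mu> * ((norm (T x1))\<^sup>2 + (norm (T x2))\<^sup>2) - s * (norm (T x))\<^sup>2"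
    unfolding L[OF functional_on_ell2_nth[OF T]]
    by (rule sums_unique2) (intro sums_add sums_diff sums_mult ell2_norm_sums)
  moreover have "y1 \<in> X" "y2 \<in> X"
    unfolding y1_def y2_def by (intro bcontfun.subspace_add bcontfun.subspace_scale subspace x)+
  ultimately show ?thesis using L[OF functional_on_apply] by blast
qed

lemma witness_if_not_two_summing:
  assumes "\<not> two_summing_property bcontfun_scale X"
  obtains x1 x2 where "x1 \<in> X" "x2 \<in> X" "square_bounded x1 x2"
    "\<And>x. x \<in> X \<Longrightarrow> norm x = 1 \<Longrightarrow>
       \<exists>t. (norm (apply_bcontfun x1 t))\<^sup>2 + (norm (apply_bcontfun x2 t))\<^sup>2 = 1 \<and> norm (apply_bcontfun x t) \<noteq> 1"
proof -
  obtain T :: "('a \<Rightarrow>\<^sub>C 'k) \<Rightarrow> 'k ell2" where T: "bounded_linear_on bcontfun_scale ell2_scale X UNIV T"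
    and neq: "pi2 bcontfun_scale X T \<noteq> opnorm_on X T"
    using assms unfolding two_summing_property_def by blast
  have lin: "linear_on bcontfun_scale ell2_scale X UNIV T"
    using T by (simp add: bounded_linear_on_def)
  define S where "S = {z \<in> X \<times> X. square_bounded (fst z) (snd z)}"
  have "(0, 0) \<in> S" using subspace by (simp add: S_def square_bounded_0 bcontfun.subspace_0)
  have "compact S" unfolding S_def by (rule compact_square_bounded)
  moreover have "continuous_on S (\<lambda>z. (norm (T (fst z)))\<^sup>2 + (norm (T (snd z)))\<^sup>2)"
    by (intro continuous_intros continuous_on_compose2[OF bounded_linear_on_continuous_norm[OF subspace T]])
       (auto simp: S_def)
  ultimately have "\<exists>z\<in>S. \<forall>y\<in>S. (norm (T (fst y)))\<^sup>2 + (norm (T (snd y)))\<^sup>2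
      \<le> (norm (T (fst z)))\<^sup>2 + (norm (T (snd z)))\<^sup>2"
    using \<open>(0, 0) \<in> S\<close> by (intro continuous_attains_sup) auto
  then obtain z where "z \<in> S" and z_max: "\<And>y. y \<in> S \<Longrightarrow>
      (norm (T (fst y)))\<^sup>2 + (norm (T (snd y)))\<^sup>2 \<le> (norm (T (fst z)))\<^sup>2 + (norm (T (snd z)))\<^sup>2"
    by blast
  define x1 where "x1 = fst z"
  define x2 where "x2 = snd z"
  define M where "M = (norm (T x1))\<^sup>2 + (norm (T x2))\<^sup>2"
  have x: "x1 \<in> X" "x2 \<in> X" "square_bounded x1 x2"
    using \<open>z \<in> S\<close> by (auto simp: S_def x1_def x2_def)
  have max: "(norm (T y1))\<^sup>2 + (norm (T y2))\<^sup>2 \<le> M" if "y1 \<in> X" "y2 \<in> X" "square_bounded y1 y2" for y1 y2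
    using z_max[of "(y1, y2)"] that by (simp add: S_def M_def x1_def x2_def)
  have "M \<ge> 0" by (simp add: M_def)
  have "opnorm_on X T < pi2 bcontfun_scale X T"
    using opnorm_on_le_pi2[OF subspace, of T] neq by simp
  also have "\<dots> \<le> ennreal (sqrt M)" using T max by (rule pi2_le)
  finally have op: "opnorm_on X T < ennreal (sqrt M)" .
  have T_less: "(norm (T x))\<^sup>2 < M" if "x \<in> X" "norm x \<le> 1" for x
  proof -
    have "ennreal (norm (T x)) < ennreal (sqrt M)"
      using norm_le_opnorm_on[OF that] op by (rule order_le_less_trans)
    then have "norm (T x) < sqrt M" by (simp add: ennreal_less_iff)
    then have "(norm (T x))\<^sup>2 < (sqrt M)\<^sup>2" by (intro power_strict_mono) auto
    then show ?thesis using \<open>M \<ge> 0\<close> by simp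
  qed
  \<comment> \<open>A dependent maximising pair would merge into one vector of the ball with value
    \<open>M\<close>, against \<open>T_less\<close>.\<close>
  have ind: "x1 \<noteq> x2 \<and> bcontfun.independent {x1, x2}"
  proof (rule ccontr)
    assume "\<not> ?thesis"
    from dependent_pair_one_square[OF x this lin] T_less show False
      unfolding M_def by (metis less_irrefl)
  qed
  define g where "g t = (norm (apply_bcontfun x1 t))\<^sup>2 + (norm (apply_bcontfun x2 t))\<^sup>2" for t
  have g: "0 \<le> g t" "g t \<le> 1" for t using x(3) by (auto simp: g_def square_bounded_def)
  show ?thesis
  proof (rule that[OF x])
    fix x assume "x \<in> X" "norm x = 1"
    show "\<exists>t. (norm (apply_bcontfun x1 t))\<^sup>2 + (norm (apply_bcontfun x2 t))\<^sup>2 = 1 \<and> norm (apply_bcontfun x t) \<noteq> 1"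
    proof (rule ccontr)
      assume "\<not> ?thesis"
      then have K0: "norm (apply_bcontfun x t) = 1" if "g t = 1" for t
        using that by (auto simp: g_def)
      define h where "h t = (norm (apply_bcontfun x t))\<^sup>2" for t
      have "h t \<ge> 0" for t by (simp add: h_def)
      have contg: "continuous_on A g" and conth: "continuous_on A h" for A
        unfolding g_def h_def by (intro continuous_intros continuous_on_apply_bcontfun)+
      have M: "(norm (T x))\<^sup>2 < M" using \<open>x \<in> X\<close> \<open>norm x = 1\<close> by (simp add: T_less)
      then have "M > 0" using zero_le_power2 by (rule order_le_less_trans[rotated])
      \<comment> \<open>Half of the relative gap between \<open>M\<close> and the value at
        \<open>x\<close>; the other half remains as strict gain.\<close>
      define \<epsilon> where "\<epsilon> = (M - (norm (T x))\<^sup>2) / (2 * M)"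
      have \<epsilon>: "0 < \<epsilon>" "\<epsilon> \<le> 1 / 2" "\<epsilon> * M < M - (norm (T x))\<^sup>2"
        using M \<open>M > 0\<close> by (simp_all add: \<epsilon>_def field_simps)
      \<comment> \<open>Only on \<open>W\<close> can the perturbation fail to lower
        \<open>g\<close>. The set \<open>W\<close> avoids the points with \<open>g t = 1\<close>,
        where also \<open>h t = 1\<close>.\<close>
      define W where "W = {t. \<epsilon> * g t \<le> g t - h t}"
      \<comment> \<open>Compactness of \<open>W\<close> turns \<open>g < 1\<close> into a uniform
        gap; for empty \<open>W\<close> any positive value will do.\<close>
      obtain \<delta> where \<delta>: "\<delta> > 0" "\<And>t. t \<in> W \<Longrightarrow> g t \<le> 1 - \<delta>"
      proof (cases "W = {}")
        case False
        have "closed W" unfolding W_def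
          by (intro closed_Collect_le continuous_intros contg conth)
        then have "compact W" using compact_UNIV by (metis compact_Int_closed inf_top_left)
        then obtain t0 where t0: "t0 \<in> W" "\<And>t. t \<in> W \<Longrightarrow> g t \<le> g t0"
          using continuous_attains_sup[OF _ False contg] by blast
        have "g t0 \<noteq> 1" using K0[of t0] t0(1) \<epsilon> by (auto simp: W_def h_def)
        then show ?thesis using t0 g[of t0] by (intro that[of "1 - g t0"]) auto
      qed (rule that[of 1], auto)
      obtain c d where cd: "x = bcontfun_scale c x1 + bcontfun_scale d x2"
        using independent_pair_spans[OF x(1,2)] ind \<open>x \<in> X\<close> bcontfun_mem_span_pairE by blast
      define C where "C = (norm c)\<^sup>2 + (norm d)\<^sup>2"
      have "C \<ge> 0" by (simp add: C_def)
      \<comment> \<open>On \<open>W\<close> the perturbation adds at most \<open>s\<close>, so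
        \<open>s \<le> \<delta>\<close> keeps the new form bounded by one;
        \<open>s * C \<le> 1\<close> keeps it positive. The \<open>+ 1\<close> keeps the denominator
        positive.\<close>
      define s where "s = min \<delta> (1 / (C + 1))"
      have s: "s > 0" "s \<le> \<delta>" "s * C \<le> 1"
      proof -
        have "s * C \<le> 1 / (C + 1) * C" using \<open>C \<ge> 0\<close> by (intro mult_right_mono) (auto simp: s_def)
        also have "\<dots> \<le> 1" using \<open>C \<ge> 0\<close> by simp
        finally show "s * C \<le> 1" .
      qed (use \<delta> \<open>C \<ge> 0\<close> in \<open>auto simp: s_def\<close>)
      have "\<epsilon> * s \<le> 1 * s" using \<epsilon> s by (intro mult_right_mono) auto
      then have "s * ((norm c)\<^sup>2 + (norm d)\<^sup>2) \<le> 1 + s - \<epsilon> * s"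
        using s unfolding C_def[symmetric] by linarith
      \<comment> \<open>The form \<open>A + s (A - B - \<epsilon> A)\<close> is regrouped as
        \<open>\<mu> A - s B\<close> with \<open>\<mu> = 1 + s - \<epsilon> * s\<close>.\<close>
      then obtain y1 y2 where y: "y1 \<in> X" "y2 \<in> X"
        and y_apply: "\<And>t. (norm (apply_bcontfun y1 t))\<^sup>2 + (norm (apply_bcontfun y2 t))\<^sup>2
          = (1 + s - \<epsilon> * s) * g t - s * h t"
        and y_T: "(norm (T y1))\<^sup>2 + (norm (T y2))\<^sup>2 = (1 + s - \<epsilon> * s) * M - s * (norm (T x))\<^sup>2"
        using perturbed_pair[OF x(1,2) lin less_imp_le[OF s(1)] _ cd] unfolding g_def h_def M_def by blast
      have "(1 + s - \<epsilon> * s) * g t - s * h t \<le> 1" for t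
      proof -
        have eq: "(1 + s - \<epsilon> * s) * g t - s * h t = g t + s * (g t - h t - \<epsilon> * g t)"
          by (simp add: algebra_simps)
        show ?thesis
        proof (cases "t \<in> W")
          case True
          have "g t - h t - \<epsilon> * g t \<le> 1"
            using g[of t] \<open>h t \<ge> 0\<close> \<epsilon>(1) mult_nonneg_nonneg[of \<epsilon> "g t"] by linarith
          then have "s * (g t - h t - \<epsilon> * g t) \<le> s * 1" using s by (intro mult_left_mono) auto
          then show ?thesis using \<delta>(2)[OF True] s eq by linarith
        next
          case False
          then have "s * (g t - h t - \<epsilon> * g t) \<le> 0" using s by (intro mult_nonneg_nonpos) (auto simp: W_def)
          then show ?thesis using g[of t] eq by linarith
        qed
      qed
      then have "square_bounded y1 y2" by (simp add: square_bounded_def y_apply)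
      \<comment> \<open>The new pair exceeds \<open>M\<close> by this product, which is positive by
        the choice of \<open>\<epsilon>\<close>.\<close>
      from max[OF y this] have "s * (M - (norm (T x))\<^sup>2 - \<epsilon> * M) \<le> 0"
        unfolding y_T by (simp add: algebra_simps)
      with s \<epsilon> show False by (simp add: mult_le_0_iff)
    qed
  qed
qed

text \<open>When the property fails, \<open>K0\<close> is the closed set on which the squares of the
  maximising pair sum to one. Conversely, the indicator bound supplies the lower estimate on
  \<open>K0\<close>.\<close>

theorem not_two_summing_iff:
  "\<not> two_summing_property bcontfun_scale X \<longleftrightarrow>
     (\<exists>x1\<in>X. \<exists>x2\<in>X. \<exists>K0 :: 'a set. closed K0 \<and>
        (\<forall>t. indicat_real K0 t \<le> (norm (apply_bcontfun x1 t))\<^sup>2 + (norm (apply_bcontfun x2 t))\<^sup>2 \<and>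
             (norm (apply_bcontfun x1 t))\<^sup>2 + (norm (apply_bcontfun x2 t))\<^sup>2 \<le> 1) \<and>
        (\<forall>x\<in>X. norm x = 1 \<longrightarrow> \<not> (\<forall>t\<in>K0. norm (apply_bcontfun x t) = 1)))"
  (is "?L \<longleftrightarrow> ?R")
proof
  assume ?L
  then obtain x1 x2 where x: "x1 \<in> X" "x2 \<in> X" "square_bounded x1 x2"
    and w: "\<And>x. x \<in> X \<Longrightarrow> norm x = 1 \<Longrightarrow>
      \<exists>t. (norm (apply_bcontfun x1 t))\<^sup>2 + (norm (apply_bcontfun x2 t))\<^sup>2 = 1 \<and> norm (apply_bcontfun x t) \<noteq> 1"
    by (rule witness_if_not_two_summing) blast
  define K0 where "K0 = {t. (norm (apply_bcontfun x1 t))\<^sup>2 + (norm (apply_bcontfun x2 t))\<^sup>2 = 1}"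
  have "closed K0"
    unfolding K0_def by (intro closed_Collect_eq continuous_intros continuous_on_apply_bcontfun)
  moreover have "indicat_real K0 t \<le> (norm (apply_bcontfun x1 t))\<^sup>2 + (norm (apply_bcontfun x2 t))\<^sup>2" for t
    by (auto simp: K0_def indicator_def)
  moreover have "\<not> (\<forall>t\<in>K0. norm (apply_bcontfun x t) = 1)" if "x \<in> X" "norm x = 1" for x
    using w[OF that] by (auto simp: K0_def)
  ultimately show ?R using x unfolding square_bounded_def by blast
next
  assume ?R
  then obtain x1 x2 and K0 :: "'a set" where x: "x1 \<in> X" "x2 \<in> X"
    and sq: "\<And>t. indicat_real K0 t \<le> (norm (apply_bcontfun x1 t))\<^sup>2 + (norm (apply_bcontfun x2 t))\<^sup>2"
      "\<And>t. (norm (apply_bcontfun x1 t))\<^sup>2 + (norm (apply_bcontfun x2 t))\<^sup>2 \<le> 1"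
    and w: "\<And>x. x \<in> X \<Longrightarrow> norm x = 1 \<Longrightarrow> \<exists>t\<in>K0. norm (apply_bcontfun x t) \<noteq> 1"
    by blast
  show ?L
  proof (rule not_two_summing_if_witness[OF x])
    show "1 \<le> (norm (apply_bcontfun x1 t))\<^sup>2 + (norm (apply_bcontfun x2 t))\<^sup>2" if "t \<in> K0" for t
      using sq(1)[of t] that by simp
  qed (use sq w in \<open>auto simp: square_bounded_def\<close>)
qed

end

text \<open>The real and the complex case are two instances of the locale.\<close>

theorem corollary2p7:
  fixes X_real :: "('a::metric_space \<Rightarrow>\<^sub>C real) set"
    and X_complex :: "('a \<Rightarrow>\<^sub>C complex) set"
  assumes "compact (UNIV :: 'a set)"
  shows
    "(bcontfun.subspace X_real \<and> bcontfun.dim X_real = 2 \<longrightarrow>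
       (\<not> two_summing_property bcontfun_scale X_real \<longleftrightarrow>
         (\<exists>x1\<in>X_real. \<exists>x2\<in>X_real. \<exists>K0 :: 'a set. closed K0 \<and>
            (\<forall>t. indicat_real K0 t \<le> (norm (apply_bcontfun x1 t))\<^sup>2 + (norm (apply_bcontfun x2 t))\<^sup>2 \<and>
                 (norm (apply_bcontfun x1 t))\<^sup>2 + (norm (apply_bcontfun x2 t))\<^sup>2 \<le> 1) \<and>
            (\<forall>x\<in>X_real. norm x = 1 \<longrightarrow> \<not> (\<forall>t\<in>K0. norm (apply_bcontfun x t) = 1)))))
     \<and>
     (bcontfun.subspace X_complex \<and> bcontfun.dim X_complex = 2 \<longrightarrow>
       (\<not> two_summing_property bcontfun_scale X_complex \<longleftrightarrow>
         (\<exists>x1\<in>X_complex. \<exists>x2\<in>X_complex. \<exists>K0 :: 'a set. closed K0 \<and>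
            (\<forall>t. indicat_real K0 t \<le> (norm (apply_bcontfun x1 t))\<^sup>2 + (norm (apply_bcontfun x2 t))\<^sup>2 \<and>
                 (norm (apply_bcontfun x1 t))\<^sup>2 + (norm (apply_bcontfun x2 t))\<^sup>2 \<le> 1) \<and>
            (\<forall>x\<in>X_complex. norm x = 1 \<longrightarrow> \<not> (\<forall>t\<in>K0. norm (apply_bcontfun x t) = 1)))))"
  using assms bcontfun_plane.not_two_summing_iff[of X_real] bcontfun_plane.not_two_summing_iff[of X_complex]
  by (simp add: bcontfun_plane_def)

end
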